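(* Let $s\ge2$, $h$, $t$ be positive integers with $t\mid h$, and let $q=2^h$. Assume that $\mathbb{F}_q$ is the splitting field of $g(x)=x^{2^s+1}+\sum_{i=1}^{2^{s-1}}a_ix^{2^s+1-i}+c\in\mathbb{F}_{2^t}[x]$ with $c\neq0$ and $a_i\ne0$ for $1\le i\le2^{s-1}$, that $\alpha_1,\dots,\alpha_{2^s+1}$ are all the roots of $g(x)$ and are pairwise distinct, and let $v_i=\big(\alpha_i^{2^{s-1}}+\sum_{j=1}^{2^{s-2}}a_{2j}^{2^{h-1}}\alpha_i^{2^{s-1}-j}\big)^{-1}$ for $1\le i\le2^s+1$. Let $\boldsymbol{\alpha}=(\alpha_1,\dots,\alpha_{2^s+1})$, $\boldsymbol{v}=(v_1,\dots,v_{2^s+1})$, $\eta_{2^{s-1}+1}\in\mathbb{F}_q^*$, and $$\mathcal{S}_2=\Big\{\sum_{i=0}^{2^{s-1}-1}f_ix^i+f_0\,\eta_{2^{s-1}+1}\Big(\sum_{j=1}^{2^{s-1}}a_jx^{2^s-j}+x^{2^s}\Big): f_i\in\mathbb{F}_q\text{ for }0\le i\le2^{s-1}-1\Big\},$$ and let $\mathcal{C}_2=ev_{\boldsymbol{\alpha},\boldsymbol{v}}(\mathcal{S}_2)$. Then there exists a $[[2^s+1,\,1,\,\mathrm{wt}(\mathcal{C}_2^\perp\setminus\mathcal{C}_2)]]_q$ quantum stabilizer code.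
   Context: $ev_{\boldsymbol{\alpha},\boldsymbol{v}}(f)=(v_1f(\alpha_1),\dots,v_nf(\alpha_n))$. $\mathcal{C}^\perp$ is the Euclidean dual. For a set $X$ of vectors, $\mathrm{wt}(X)$ is the minimum Hamming weight of a nonzero element of $X$. Quantum codes: let $q=p^h$, $\zeta=e^{2\pi i/p}$, $\mathrm{Tr}:\mathbb{F}_q\to\mathbb{F}_p$ the trace; on $\mathbb{C}^q$ with orthonormal basis $\{|x\rangle:x\in\mathbb{F}_q\}$ let $X(a)|x\rangle=|x+a\rangle$, $Z(b)|x\rangle=\zeta^{\mathrm{Tr}(bx)}|x\rangle$, and for $\boldsymbol{a},\boldsymbol{b}\in\mathbb{F}_q^n$ let $X(\boldsymbol{a})=\bigotimes X(a_i)$, $Z(\boldsymbol{b})=\bigotimes Z(b_i)$ on $(\mathbb{C}^q)^{\otimes n}$. The error group consists of all $\zeta^cX(\boldsymbol{a})Z(\boldsymbol{b})$; the weight of such an element is the number of $i$ with $(a_i,b_i)\neq(0,0)$. A stabilizer code is a nonzero joint $+1$-eigenspace of an abelian subgroup of the error group. It is an $[[n,K,d]]_q$ code if it has dimension $q^K$ and minimum distance $d$, i.e. $d$ is the largest integer such that every error $E$ of weight less than $d$ is detectable ($PEP=c_EP$ for a scalar $c_E$, $P$ the orthogonal projector onto the code). *)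

theory Defs
  imports
    "HOL-Analysis.Analysis"
    "HOL-Computational_Algebra.Computational_Algebra"
    "HOL-Algebra.Group"
begin

section \<open>Subfields and splitting fields\<close>

definition is_subfield :: "'a::field set \<Rightarrow> bool" where
  "is_subfield K \<longleftrightarrow> 0 \<in> K \<and> 1 \<in> K \<and>
     (\<forall>x\<in>K. \<forall>y\<in>K. x + y \<in> K \<and> x * y \<in> K) \<and>
     (\<forall>x\<in>K. - x \<in> K \<and> inverse x \<in> K)"

text \<open>The whole type is the field in question, and the subfield \<open>K\<close> is the base field.\<close>

definition is_splitting_field_over :: "'a::field set \<Rightarrow> 'a poly \<Rightarrow> bool" where
  "is_splitting_field_over K g \<longleftrightarrow>
     is_subfield K \<and> (\<forall>i. coeff g i \<in> K) \<and>
     (\<exists>A. g = smult (lead_coeff g) (\<Prod>\<alpha>\<in>#A. [:- \<alpha>, 1:])) \<and>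
     (\<forall>L. is_subfield L \<longrightarrow> K \<subseteq> L \<longrightarrow> {x. poly g x = 0} \<subseteq> L \<longrightarrow> L = UNIV)"


section \<open>Linear codes\<close>

text \<open>Words of length \<open>n\<close> are elements of \<open>'a ^ 'n\<close> with \<open>CARD('n) = n\<close>.\<close>

definition ev :: "'a::field ^ 'n \<Rightarrow> 'a ^ 'n \<Rightarrow> 'a poly \<Rightarrow> 'a ^ 'n" where
  "ev \<alpha> v f = (\<chi> i. v $ i * poly f (\<alpha> $ i))"

definition euclidean_dual :: "('a::field ^ 'n) set \<Rightarrow> ('a ^ 'n) set" where
  "euclidean_dual C = {y. \<forall>x\<in>C. (\<Sum>i\<in>UNIV. x $ i * y $ i) = 0}"

definition hamming_weight :: "'a::zero ^ 'n \<Rightarrow> nat" where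
  "hamming_weight x = card {i. x $ i \<noteq> 0}"

definition wt :: "('a::zero ^ 'n) set \<Rightarrow> nat" where
  "wt X = Min (hamming_weight ` (X - {0}))"


section \<open>The error group\<close>

text \<open>The absolute trace \<open>x + x\<^sup>p + \<dots> + x ^ p ^ (h - 1)\<close> of the field with \<open>p ^ h\<close> elements,
  and its value in the prime field as a representative in \<open>{0..<p}\<close>.\<close>

definition field_trace :: "'a::finite_field \<Rightarrow> 'a" where
  "field_trace x = (\<Sum>i<(THE h. CARD('a) = CHAR('a) ^ h). x ^ (CHAR('a) ^ i))"

definition trace_rep :: "'a::finite_field \<Rightarrow> nat" where
  "trace_rep x = (THE k. k < CHAR('a) \<and> of_nat k = field_trace x)"

definition zeta :: "'a::finite_field itself \<Rightarrow> complex" where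
  "zeta _ = exp (2 * of_real pi * \<i> / of_nat CHAR('a))"

text \<open>The space with orthonormal basis indexed by the field is \<open>complex ^ 'a\<close>, with
  \<open>axis x 1\<close> for the basis vector \<open>|x\<rangle>\<close>; a matrix entry \<open>A $ y $ x\<close> is the coefficient of
  \<open>|y\<rangle>\<close> in \<open>A |x\<rangle>\<close>.\<close>

definition X1 :: "'a \<Rightarrow> complex ^ ('a::finite_field) ^ ('a::finite_field)" where
  "X1 a = (\<chi> y x. if y = x + a then 1 else 0)"

definition Z1 :: "'a \<Rightarrow> complex ^ ('a::finite_field) ^ ('a::finite_field)" where
  "Z1 b = (\<chi> y x. if y = x then zeta TYPE('a) ^ trace_rep (b * x) else 0)"

lemma X1_basis: "X1 a *v axis x 1 = axis (x + a) 1"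
  by (auto simp: X1_def matrix_vector_mult_def vec_eq_iff axis_def if_distrib cong: if_cong
      intro!: sum.neutral)

lemma Z1_basis: "Z1 b *v axis x 1 = zeta TYPE('a) ^ trace_rep (b * x) *s axis x 1"
  for x :: "'a::finite_field"
  by (auto simp: Z1_def matrix_vector_mult_def vec_eq_iff axis_def if_distrib cong: if_cong
      intro!: sum.neutral)

text \<open>The \<open>n\<close>-fold tensor power of \<open>complex ^ 'a\<close> is \<open>complex ^ ('a ^ 'n)\<close>: the basis vector
  \<open>axis x 1\<close> is the product vector of the \<open>|x $ i\<rangle>\<close>, and a tensor product of operators has
  as entries the products of the entries of its factors.\<close>

definition tensor :: "('n \<Rightarrow> complex ^ 'a ^ 'a) \<Rightarrow> complex ^ ('a ^ 'n) ^ ('a::finite ^ 'n)" where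
  "tensor A = (\<chi> y x. \<Prod>i\<in>UNIV. A i $ (y $ i) $ (x $ i))"

definition Xn :: "'a::finite_field ^ 'n \<Rightarrow> complex ^ ('a ^ 'n) ^ ('a ^ 'n)" where
  "Xn a = tensor (\<lambda>i. X1 (a $ i))"

definition Zn :: "'a::finite_field ^ 'n \<Rightarrow> complex ^ ('a ^ 'n) ^ ('a ^ 'n)" where
  "Zn b = tensor (\<lambda>i. Z1 (b $ i))"

definition error :: "nat \<Rightarrow> 'a::finite_field ^ 'n \<Rightarrow> 'a ^ 'n \<Rightarrow> complex ^ ('a ^ 'n) ^ ('a ^ 'n)" where
  "error c a b = mat (zeta TYPE('a) ^ c) ** Xn a ** Zn b"

definition error_weight :: "'a::zero ^ 'n \<Rightarrow> 'a ^ 'n \<Rightarrow> nat" where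
  "error_weight a b = card {i. (a $ i, b $ i) \<noteq> (0, 0)}"

definition error_group :: "(complex ^ ('a::finite_field ^ 'n) ^ ('a ^ 'n)) monoid" where
  "error_group = \<lparr>carrier = {error c a b | c a b. True}, monoid.mult = (**), one = mat 1\<rparr>"


section \<open>Stabilizer codes\<close>

definition joint_eigenspace :: "(complex ^ 'm ^ 'm) set \<Rightarrow> (complex ^ 'm) set" where
  "joint_eigenspace S = {\<psi>. \<forall>E\<in>S. E *v \<psi> = \<psi>}"

definition is_stabilizer_code :: "(complex ^ ('a::finite_field ^ 'n)) set \<Rightarrow> bool" where
  "is_stabilizer_code Q \<longleftrightarrow>
     (\<exists>S. subgroup S error_group \<and> comm_group (error_group\<lparr>carrier := S\<rparr>) \<and>
          Q = joint_eigenspace S \<and> Q \<noteq> {0})"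

definition conj_transpose :: "complex ^ 'm ^ 'k \<Rightarrow> complex ^ 'k ^ 'm" where
  "conj_transpose A = (\<chi> i j. cnj (A $ j $ i))"

definition is_orth_projector :: "complex ^ 'm ^ 'm \<Rightarrow> (complex ^ 'm) set \<Rightarrow> bool" where
  "is_orth_projector P Q \<longleftrightarrow> P ** P = P \<and> conj_transpose P = P \<and> range ((*v) P) = Q"

definition detectable :: "(complex ^ 'm) set \<Rightarrow> complex ^ 'm ^ 'm \<Rightarrow> bool" where
  "detectable Q E \<longleftrightarrow> (\<exists>P c. is_orth_projector P Q \<and> P ** E ** P = mat c ** P)"

definition detects_below :: "(complex ^ ('a::finite_field ^ 'n)) set \<Rightarrow> nat \<Rightarrow> bool" where
  "detects_below Q d \<longleftrightarrow> (\<forall>c a b. error_weight a b < d \<longrightarrow> detectable Q (error c a b))"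

definition has_min_distance :: "(complex ^ ('a::finite_field ^ 'n)) set \<Rightarrow> nat \<Rightarrow> bool" where
  "has_min_distance Q d \<longleftrightarrow> detects_below Q d \<and> (\<forall>d'. detects_below Q d' \<longrightarrow> d' \<le> d)"

text \<open>\<open>Q\<close> is an \<open>[[n, K, d]]\<^sub>q\<close> stabilizer code; \<open>vec.dim\<close> is the dimension over the complex numbers.\<close>

definition is_quantum_stabilizer_code ::
  "nat \<Rightarrow> nat \<Rightarrow> nat \<Rightarrow> nat \<Rightarrow> (complex ^ ('a::finite_field ^ 'n)) set \<Rightarrow> bool" where
  "is_quantum_stabilizer_code n K d q Q \<longleftrightarrow>
     CARD('n) = n \<and> CARD('a) = q \<and>
     is_stabilizer_code Q \<and> vec.dim Q = q ^ K \<and> has_min_distance Q d"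

end

theory Submission
  imports Defs "HOL-Number_Theory.Cong"
begin

text \<open>
  Since \<open>g'\<close> is the square of the expression whose inverse is \<open>v\<^sub>i\<close>, the Euclidean product of two
  codewords is \<open>\<Sum> f(\<alpha>\<^sub>i) f'(\<alpha>\<^sub>i) / g'(\<alpha>\<^sub>i)\<close>, and such a sum vanishes for every polynomial of degree
  at most \<open>degree g - 2\<close> in place of \<open>f f'\<close>. Modulo \<open>g\<close>, and in characteristic 2, the product of two
  elements of \<open>S2\<close> reduces to such a polynomial, so \<open>C2\<close> is self-orthogonal, of dimension \<open>2 ^ (s - 1)\<close>.
  The operators \<open>X(a) Z(b)\<close> with \<open>a, b \<in> C2\<close> then form an abelian group. Its joint eigenspace consists
  of the functions that are supported on the dual of \<open>C2\<close> and constant on the cosets of \<open>C2\<close>, so its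
  dimension is the index of \<open>C2\<close> in its dual. An error \<open>X(a) Z(b)\<close> acts on this space as a scalar if
  \<open>a, b \<in> C2\<close>, and the projector annihilates its action if \<open>a\<close> or \<open>b\<close> lies outside the dual; a word
  of minimum weight in the dual but not in \<open>C2\<close> gives an undetectable error.
\<close>

section \<open>The additive character of a finite field\<close>

text \<open>The canonical additive character of the field; every nonzero entry of an error operator
  is a power of \<open>zeta\<close> times one of its values.\<close>

definition add_char :: "'a::finite_field \<Rightarrow> complex" where
  "add_char x = zeta TYPE('a) ^ trace_rep x"

text \<open>The images of the numbers below \<open>p\<close> are already \<open>p\<close> distinct
  roots of \<open>x ^ p - x\<close>, which has no more than \<open>p\<close>. This places the trace
  in the prime field.\<close>

lemma power_CHAR_eq_selfE:
  fixes x :: "'a::finite_field"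
  assumes "x ^ CHAR('a) = x"
  obtains k where "k < CHAR('a)" and "of_nat k = x"
proof -
  define p where "p = CHAR('a)"
  define f :: "'a poly" where "f = monom 1 p - monom 1 1"
  have p: "prime p"
    by (simp add: p_def)
  hence "p > 1"
    by (rule prime_gt_1_nat)
  have pow: "(of_nat k :: 'a) ^ p = of_nat k" for k
    by (induction k) (use \<open>p > 1\<close> in \<open>simp_all add: p_def freshmans_dream\<close>)
  have "coeff f p = 1"
    using \<open>p > 1\<close> by (simp add: f_def)
  hence "f \<noteq> 0" by auto
  have "degree f \<le> p"
    unfolding f_def using \<open>p > 1\<close> by (intro degree_diff_le) (auto simp: degree_monom_eq)
  hence "card {y. poly f y = 0} \<le> p"
    using card_poly_roots_bound[OF \<open>f \<noteq> 0\<close>] by linarith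
  moreover have "inj_on (of_nat :: nat \<Rightarrow> 'a) {..<p}"
    by (intro inj_onI) (auto simp: of_nat_eq_iff_cong_CHAR p_def cong_def)
  hence "card ((of_nat :: nat \<Rightarrow> 'a) ` {..<p}) = p"
    by (simp add: card_image)
  moreover have "of_nat ` {..<p} \<subseteq> {y. poly f y = 0}"
    by (auto simp: f_def poly_monom pow)
  ultimately have "of_nat ` {..<p} = {y. poly f y = 0}"
    using poly_roots_finite[OF \<open>f \<noteq> 0\<close>] by (metis card_mono card_subset_eq le_antisym)
  moreover have "poly f x = 0"
    using assms by (simp add: f_def poly_monom p_def)
  ultimately have "x \<in> of_nat ` {..<p}" by simp
  then obtain k where "k < p" "x = of_nat k"
    by (elim imageE) auto
  thus ?thesis
    using that[of k] by (simp add: p_def)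
qed

lemma zeta_power_eq_1_iff: "zeta TYPE('a::finite_field) ^ k = 1 \<longleftrightarrow> CHAR('a) dvd k"
proof -
  have "zeta TYPE('a) ^ k = exp (2 * of_real pi * \<i> * of_nat k / of_nat CHAR('a))"
    by (simp add: zeta_def mult_ac flip: exp_of_nat_mult)
  thus ?thesis
    using complex_root_unity_eq_1[of "CHAR('a)" k] by (simp add: Suc_leI)
qed

context
  fixes h :: nat
  assumes card_field: "CARD('a::finite_field) = CHAR('a) ^ h"
begin

lemma field_trace_eq: "field_trace (x::'a) = (\<Sum>i<h. x ^ (CHAR('a) ^ i))"
proof -
  have "(THE h. CARD('a) = CHAR('a) ^ h) = h"
    using prime_gt_1_nat[of "CHAR('a)"] by (intro the_equality) (auto simp: card_field)
  thus ?thesis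
    by (simp add: field_trace_def)
qed

lemma field_trace_add: "field_trace (x + y :: 'a) = field_trace x + field_trace y"
  by (simp add: field_trace_eq freshmans_dream' sum.distrib)

lemma field_trace_power_CHAR: "field_trace (x :: 'a) ^ CHAR('a) = field_trace x"
proof -
  have "field_trace x ^ CHAR('a) = (\<Sum>i<h. x ^ (CHAR('a) ^ Suc i))"
    by (simp add: field_trace_eq freshmans_dream_sum mult_ac flip: power_mult)
  \<comment> \<open>Both sides are the sum over the indices \<open>0\<close> to \<open>h\<close>: on
    the left \<open>x\<close> is the summand at \<open>0\<close>, on the right the summand at
    \<open>h\<close>, since \<open>x ^ CARD('a) = x\<close>.\<close>
  also have "x + \<dots> = x + field_trace x"
    using sum.lessThan_Suc_shift[of "\<lambda>i. x ^ (CHAR('a) ^ i)" h]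
      finite_field_power_card_eq_same[of x]
    by (simp add: field_trace_eq card_field)
  hence "(\<Sum>i<h. x ^ (CHAR('a) ^ Suc i)) = field_trace x"
    by simp
  finally show ?thesis .
qed

lemma of_nat_trace_rep: "of_nat (trace_rep x) = field_trace (x :: 'a)"
proof -
  obtain k where k: "k < CHAR('a)" "of_nat k = field_trace x"
    using power_CHAR_eq_selfE[OF field_trace_power_CHAR] by blast
  moreover have "j = k" if "j < CHAR('a)" "of_nat j = field_trace x" for j
  proof -
    have "(of_nat j :: 'a) = of_nat k"
      using that k by simp
    thus ?thesis
      using that(1) k(1) by (simp add: of_nat_eq_iff_cong_CHAR cong_def)
  qed
  ultimately have "trace_rep x = k"
    unfolding trace_rep_def using k by (intro the_equality) blast+
  with k show ?thesis by simp
qed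

text \<open>\<open>trace_rep\<close> is additive only modulo the characteristic, which suffices
  because \<open>zeta\<close> is a root of unity of that order.\<close>

lemma add_char_add: "add_char (x + y :: 'a) = add_char x * add_char y"
proof -
  have "(of_nat (trace_rep (x + y)) :: 'a) = of_nat (trace_rep x + trace_rep y)"
    by (simp add: of_nat_trace_rep field_trace_add)
  hence *: "[trace_rep (x + y) = trace_rep x + trace_rep y] (mod CHAR('a))"
    by (simp only: of_nat_eq_iff_cong_CHAR)
  have red: "zeta TYPE('a) ^ k = zeta TYPE('a) ^ (k mod CHAR('a))" for k
  proof -
    have "zeta TYPE('a) ^ k = zeta TYPE('a) ^ (CHAR('a) * (k div CHAR('a)) + k mod CHAR('a))"
      by simp
    also have "\<dots> = zeta TYPE('a) ^ (k mod CHAR('a))"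
      proof -
      have "zeta TYPE('a) ^ CHAR('a) = 1"
        by (simp add: zeta_power_eq_1_iff)
      thus ?thesis
        by (simp only: power_add power_mult power_one mult_1)
    qed
    finally show ?thesis .
  qed
  have "add_char (x + y) = zeta TYPE('a) ^ (trace_rep (x + y) mod CHAR('a))"
    unfolding add_char_def by (rule red)
  also have "\<dots> = zeta TYPE('a) ^ ((trace_rep x + trace_rep y) mod CHAR('a))"
    using * by (simp only: cong_def)
  also have "\<dots> = zeta TYPE('a) ^ (trace_rep x + trace_rep y)"
    by (rule red[symmetric])
  finally have "add_char (x + y) = zeta TYPE('a) ^ (trace_rep x + trace_rep y)" .
  thus ?thesis
    by (simp add: add_char_def power_add)
qed

lemma add_char_0: "add_char (0 :: 'a) = 1"
proof -
  have "add_char (0::'a) \<noteq> 0"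
    by (simp add: add_char_def zeta_def)
  thus ?thesis
    using add_char_add[of 0 0] by simp
qed

lemma add_char_sum: "add_char (sum f A :: 'a) = (\<Prod>i\<in>A. add_char (f i))"
  by (induction A rule: infinite_finite_induct) (simp_all add: add_char_0 add_char_add)

text \<open>The trace is a polynomial of degree at most \<open>CHAR('a) ^ (h - 1)\<close>, nonzero
  because of its linear coefficient, so it has too few roots to vanish on the whole field.\<close>

lemma add_char_nontrivial: obtains x :: 'a where "add_char x \<noteq> 1"
proof -
  have p: "CHAR('a) > 1"
    by (rule prime_gt_1_nat[OF CHAR_prime])
  have "h > 0"
  proof (rule ccontr)
    assume "\<not> h > 0"
    hence "CARD('a) = 1" by (simp add: card_field)
    moreover have "card {0, 1::'a} \<le> CARD('a)" by (intro card_mono) auto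
    ultimately show False by simp
  qed
  define f :: "'a poly" where "f = (\<Sum>i<h. monom 1 (CHAR('a) ^ i))"
  have "coeff f 1 = (\<Sum>i<h. if i = 0 then 1 else 0)"
    using p by (auto simp: f_def coeff_sum intro!: sum.cong)
  hence "coeff f 1 = 1"
    using \<open>h > 0\<close> by simp
  hence "f \<noteq> 0" by auto
  have "degree f \<le> CHAR('a) ^ (h - 1)"
    unfolding f_def using p
    by (intro degree_sum_le) (auto simp: degree_monom_eq intro!: power_increasing)
  hence "card {x. poly f x = 0} \<le> CHAR('a) ^ (h - 1)"
    using card_poly_roots_bound[OF \<open>f \<noteq> 0\<close>] by linarith
  also have "\<dots> < CARD('a)"
    using p \<open>h > 0\<close> by (simp add: card_field)
  finally have "{x. poly f x = 0} \<noteq> UNIV" by auto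
  then obtain x where x: "poly f x \<noteq> 0" by auto
  hence "field_trace x \<noteq> 0"
    by (simp add: field_trace_eq f_def poly_sum poly_monom)
  hence "add_char x \<noteq> 1"
    by (simp add: add_char_def zeta_power_eq_1_iff flip: of_nat_trace_rep of_nat_eq_0_iff_char_dvd)
  thus ?thesis by (rule that)
qed

end

section \<open>Stabilizer codes from self-orthogonal linear codes\<close>

lemma mem_euclidean_dual: "y \<in> euclidean_dual C \<longleftrightarrow> (\<forall>x\<in>C. scalar_product x y = 0)"
  by (simp add: euclidean_dual_def scalar_product_def)

lemma scalar_product_commute:
  "scalar_product x y = scalar_product y (x :: 'a::comm_semiring_1 ^ 'n)"
  by (simp add: scalar_product_def mult.commute)

lemma scalar_product_add_right:
  "scalar_product x (y + z) = scalar_product x y + scalar_product x (z :: 'a::comm_semiring_1 ^ 'n)"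
  by (simp add: scalar_product_def distrib_left sum.distrib)

lemma scalar_product_add_left:
  "scalar_product (x + y) z = scalar_product x z + scalar_product y (z :: 'a::comm_semiring_1 ^ 'n)"
  by (simp add: scalar_product_def distrib_right sum.distrib)

lemma scalar_product_uminus_right:
  "scalar_product x (- y) = - scalar_product x (y :: 'a::comm_ring_1 ^ 'n)"
  by (simp add: scalar_product_def sum_negf)

lemma scalar_product_uminus_left:
  "scalar_product (- x) y = - scalar_product x (y :: 'a::comm_ring_1 ^ 'n)"
  by (simp add: scalar_product_def sum_negf)

lemma scalar_product_diff_right:
  "scalar_product x (y - z) = scalar_product x y - scalar_product x (z :: 'a::comm_ring_1 ^ 'n)"
  by (simp add: scalar_product_def right_diff_distrib sum_subtractf)

lemma scalar_product_scale_left: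
  "scalar_product (c *s x) y = c * scalar_product x (y :: 'a::comm_semiring_1 ^ 'n)"
  by (simp add: scalar_product_def sum_distrib_left mult.assoc)

lemma scalar_product_zero [simp]:
  "scalar_product 0 x = 0" "scalar_product x (0 :: 'a::comm_semiring_1 ^ 'n) = 0"
  by (simp_all add: scalar_product_def)

lemmas scalar_product_linear = scalar_product_add_right scalar_product_add_left
  scalar_product_uminus_right scalar_product_uminus_left scalar_product_diff_right

lemma mat_mult_nth: "(mat c ** A) $ i $ j = c * A $ i $ j"
  for A :: "'a::comm_semiring_1 ^ 'm ^ 'k"
  by (simp add: matrix_matrix_mult_def mat_def if_distrib if_distribR cong: if_cong)

lemma mult_mat_commute: "A ** (mat c ** B) = mat c ** (A ** B)"
  for A :: "'a::comm_semiring_1 ^ 'm ^ 'k"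
proof -
  have "(\<Sum>k\<in>UNIV. A $ i $ k * (mat c ** B) $ k $ j) = c * (\<Sum>k\<in>UNIV. A $ i $ k * B $ k $ j)" for i j
    by (simp add: mat_mult_nth sum_distrib_left mult_ac)
  thus ?thesis
    by (simp only: vec_eq_iff mat_mult_nth matrix_matrix_mult_def[of A] vec_lambda_beta) simp
qed

lemma mat_mult_vec: "mat c *v x = c *s x" for x :: "'a::comm_semiring_1 ^ 'm"
  by (simp add: vec_eq_iff matrix_vector_mult_def mat_def if_distrib if_distribR cong: if_cong)

text \<open>Translation by \<open>g\<close> permutes \<open>G\<close> and multiplies the sum by
  \<open>f g\<close>, which is not 1.\<close>

lemma sum_character_eq_0:
  fixes f :: "'b::ab_group_add \<Rightarrow> complex"
  assumes hom: "\<And>x y. x \<in> G \<Longrightarrow> y \<in> G \<Longrightarrow> f (x + y) = f x * f y"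
    and closed: "\<And>x y. x \<in> G \<Longrightarrow> y \<in> G \<Longrightarrow> x + y \<in> G" "\<And>x. x \<in> G \<Longrightarrow> - x \<in> G"
    and g: "g \<in> G" "f g \<noteq> 1"
  shows "sum f G = 0"
proof -
  have "sum f G = (\<Sum>x\<in>G. f (x + g))"
    by (rule sum.reindex_bij_witness[of _ "\<lambda>x. x + g" "\<lambda>x. x + (- g)"])
      (use closed(1)[OF _ closed(2)[OF g(1)]] closed(1)[OF _ g(1)] in auto)
  also have "\<dots> = sum f G * f g"
    by (simp add: hom g sum_distrib_right)
  finally show ?thesis
    using g(2) by simp
qed

section \<open>The error operators in coordinates and their commutation\<close>

lemma Xn_nth: "Xn a $ y $ x = (if y = x + a then 1 else 0)"
  by (auto simp: Xn_def tensor_def X1_def vec_eq_iff)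

context
  fixes h :: nat
  assumes card_field: "CARD('a::finite_field) = CHAR('a) ^ h"
begin

text \<open>The character turns the product over the tensor factors into its value at a sum, the
  scalar product.\<close>

lemma Zn_nth: "Zn b $ y $ x = (if y = x then add_char (scalar_product b x) else 0)"
  for b :: "'a ^ 'n"
  by (auto simp: Zn_def tensor_def Z1_def vec_eq_iff scalar_product_def add_char_sum[OF card_field]
      simp flip: add_char_def)

lemma error_nth:
  "error c a b $ y $ x = (if y = x + a then zeta TYPE('a) ^ c * add_char (scalar_product b x) else 0)"
  for a b :: "'a ^ 'n"
proof -
  have "error c a b $ y $ x = zeta TYPE('a) ^ c * (\<Sum>z\<in>UNIV. Xn a $ y $ z * Zn b $ z $ x)"
    unfolding error_def matrix_mul_assoc[symmetric] mat_mult_nth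
    by (simp add: matrix_matrix_mult_def)
  also have "(\<Sum>z\<in>UNIV. Xn a $ y $ z * Zn b $ z $ x) = Xn a $ y $ x * add_char (scalar_product b x)"
    by (simp add: Zn_nth if_distrib cong: if_cong)
  finally show ?thesis
    by (simp add: Xn_nth)
qed

text \<open>Each column of an error operator has a single nonzero entry, so multiplication by it
  from the right permutes and rescales columns.\<close>

lemma mult_error_nth:
  "(A ** error c a b) $ y $ x = A $ y $ (x + a) * (zeta TYPE('a) ^ c * add_char (scalar_product b x))"
  for a b :: "'a ^ 'n"
  by (simp add: matrix_matrix_mult_def error_nth if_distrib cong: if_cong)

lemma error_mult_vec_nth:
  "(error c a b *v \<psi>) $ y = zeta TYPE('a) ^ c * add_char (scalar_product b (y - a)) * \<psi> $ (y - a)"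
  for a b :: "'a ^ 'n"
proof -
  have "y = x + a \<longleftrightarrow> x = y - a" for x
    by (auto simp: algebra_simps)
  thus ?thesis
    by (simp add: matrix_vector_mult_def error_nth if_distrib if_distribR cong: if_cong)
qed

text \<open>Moving \<open>Zn b\<close> past \<open>Xn a'\<close> costs the phase
  \<open>add_char (scalar_product b a')\<close>, a power of \<open>zeta\<close>, so the product is
  again an error operator.\<close>

lemma error_mult:
  "error c a b ** error c' a' b' = error (c + c' + trace_rep (scalar_product b a')) (a + a') (b + b')"
  for a b :: "'a ^ 'n"
  by (auto simp: vec_eq_iff mult_error_nth error_nth scalar_product_linear add_char_add[OF card_field]
      power_add add_ac mult_ac simp flip: add_char_def)

lemma error_0: "error 0 0 (0 :: 'a ^ 'n) = mat 1"
  by (simp add: vec_eq_iff error_nth mat_def add_char_0[OF card_field])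

text \<open>The phase is the character of the symplectic form on pairs of words.\<close>

lemma error_commute:
  "error c a b ** error c' a' b' =
     mat (add_char (scalar_product b a' - scalar_product b' a)) ** (error c' a' b' ** error c a b)"
  for a b :: "'a ^ 'n"
proof -
  have "add_char (scalar_product b (x + a')) * add_char (scalar_product b' x) =
      add_char (scalar_product b a' - scalar_product b' a) *
      (add_char (scalar_product b' (x + a)) * add_char (scalar_product b x))" for x
    by (simp add: scalar_product_linear add_ac flip: add_char_add[OF card_field])
  thus ?thesis
    by (auto simp: vec_eq_iff mult_error_nth error_nth mat_mult_nth add_ac mult_ac)
qed

text \<open>Scaling a word of \<open>C\<close> that is not orthogonal to \<open>y\<close> makes the
  scalar product run through the whole field, where the character is nontrivial. Thus the Euclidean
  dual is also the dual with respect to the character.\<close>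

lemma ex_scalar_product_add_char:
  assumes "y \<notin> euclidean_dual C" and "\<And>k x. x \<in> C \<Longrightarrow> k *s x \<in> C"
  obtains x :: "'a ^ 'n" where "x \<in> C" and "add_char (scalar_product x y) \<noteq> 1"
proof -
  obtain x where x: "x \<in> C" "scalar_product x y \<noteq> 0"
    using assms(1) by (auto simp: mem_euclidean_dual)
  obtain k :: 'a where "add_char k \<noteq> 1"
    using add_char_nontrivial[OF card_field] .
  moreover have "scalar_product ((k / scalar_product x y) *s x) y = k"
    using x(2) by (simp add: scalar_product_scale_left)
  ultimately show ?thesis
    using that[of "(k / scalar_product x y) *s x"] assms(2)[OF x(1)] by simp
qed

end

text \<open>The setting of the CSS construction with the same linear code for shifts and phases,
  over any finite field.\<close>

locale self_orthogonal_code =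
  fixes C :: "('a::finite_field ^ 'n) set" and h :: nat
  assumes card_field: "CARD('a) = CHAR('a) ^ h"
    and subspace_C: "vec.subspace C"
    and self_orthogonal: "C \<subseteq> euclidean_dual C"
begin

lemma zero_C: "0 \<in> C" and add_C: "x \<in> C \<Longrightarrow> y \<in> C \<Longrightarrow> x + y \<in> C"
  and uminus_C: "x \<in> C \<Longrightarrow> - x \<in> C" and scale_C: "x \<in> C \<Longrightarrow> k *s x \<in> C"
  and diff_C: "x \<in> C \<Longrightarrow> y \<in> C \<Longrightarrow> x - y \<in> C"
  by (rule vec.subspace_0[OF subspace_C] vec.subspace_add[OF subspace_C] vec.subspace_neg[OF subspace_C]
      vec.subspace_scale[OF subspace_C] vec.subspace_diff[OF subspace_C]; assumption?)+

lemma diff_C_iff: "x \<in> C \<Longrightarrow> y - x \<in> C \<longleftrightarrow> y \<in> C"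
  using add_C diff_C by (metis diff_add_cancel)

lemma dual_add: "x \<in> euclidean_dual C \<Longrightarrow> y \<in> euclidean_dual C \<Longrightarrow> x + y \<in> euclidean_dual C"
  and dual_diff: "x \<in> euclidean_dual C \<Longrightarrow> y \<in> euclidean_dual C \<Longrightarrow> x - y \<in> euclidean_dual C"
  by (auto simp: mem_euclidean_dual scalar_product_linear)

lemma dual_add_C_iff: "x \<in> C \<Longrightarrow> y + x \<in> euclidean_dual C \<longleftrightarrow> y \<in> euclidean_dual C"
  using self_orthogonal by (metis add_diff_cancel_right' dual_add dual_diff subset_eq)

lemma dual_diff_C_iff: "x \<in> C \<Longrightarrow> y - x \<in> euclidean_dual C \<longleftrightarrow> y \<in> euclidean_dual C"
  using self_orthogonal by (metis diff_add_cancel dual_add dual_diff subset_eq)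

lemma scalar_product_C_dual: "x \<in> C \<Longrightarrow> y \<in> euclidean_dual C \<Longrightarrow> scalar_product x y = 0"
  by (simp add: mem_euclidean_dual)

text \<open>The sum of the character of \<open>scalar_product x y\<close> over
  \<open>x \<in> C\<close> and all \<open>y\<close> is evaluated in both orders, with the
  orthogonality of characters for each inner sum.\<close>

lemma card_mult_card_dual: "card C * card (euclidean_dual C) = CARD('a) ^ CARD('n)"
proof -
  define ch where "ch x y = add_char (scalar_product x y)" for x y :: "'a ^ 'n"
  have add: "ch (x + y) z = ch x z * ch y z" "ch x (y + z) = ch x y * ch x z" for x y z
    by (simp_all add: ch_def scalar_product_linear add_char_add[OF card_field])
  have "(\<Sum>x\<in>C. ch x y) = (if y \<in> euclidean_dual C then of_nat (card C) else 0)" for y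
  proof (cases "y \<in> euclidean_dual C")
    case True
    thus ?thesis
      by (simp add: ch_def scalar_product_C_dual add_char_0[OF card_field])
  next
    case False
    obtain x where "x \<in> C" "ch x y \<noteq> 1"
      using ex_scalar_product_add_char[OF card_field False scale_C] by (auto simp: ch_def)
    with False show ?thesis
      by (auto intro!: sum_character_eq_0 simp: add add_C uminus_C)
  qed
  hence "(\<Sum>y\<in>UNIV. \<Sum>x\<in>C. ch x y) = of_nat (card C * card (euclidean_dual C))"
    by (simp add: sum.If_cases)
  moreover have "(\<Sum>y\<in>UNIV. ch x y) = (if x = 0 then of_nat (CARD('a) ^ CARD('n)) else 0)" for x
  proof (cases "x = 0")
    case True
    thus ?thesis
      by (simp add: ch_def add_char_0[OF card_field])
  next
    case False
    then obtain i where i: "x $ i \<noteq> 0"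
      by (auto simp: vec_eq_iff)
    obtain k :: 'a where k: "add_char k \<noteq> 1"
      using add_char_nontrivial[OF card_field] .
    have "scalar_product x (axis i (k / x $ i)) = k"
      using i by (simp add: scalar_product_def axis_def if_distrib cong: if_cong)
    hence "ch x (axis i (k / x $ i)) \<noteq> 1"
      using k by (simp add: ch_def)
    with False show ?thesis
      by (auto intro!: sum_character_eq_0 simp: add)
  qed
  hence "(\<Sum>x\<in>C. \<Sum>y\<in>UNIV. ch x y) = of_nat (CARD('a) ^ CARD('n))"
    using zero_C by simp
  ultimately have "(of_nat (card C * card (euclidean_dual C)) :: complex) = of_nat (CARD('a) ^ CARD('n))"
    by (subst (asm) sum.swap) simp
  thus ?thesis
    by (simp only: of_nat_eq_iff)
qed

section \<open>The stabilizer group and its joint eigenspace\<close>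

definition stabilizer :: "(complex ^ ('a ^ 'n) ^ ('a ^ 'n)) set" where
  "stabilizer = {error 0 a b | a b. a \<in> C \<and> b \<in> C}"

definition quantum_code :: "(complex ^ ('a ^ 'n)) set" where
  "quantum_code = {\<psi>. (\<forall>y. y \<notin> euclidean_dual C \<longrightarrow> \<psi> $ y = 0) \<and> (\<forall>y. \<forall>a\<in>C. \<psi> $ (y - a) = \<psi> $ y)}"

text \<open>Restriction to the dual, followed by averaging over the cosets of
  \<open>C\<close>.\<close>

definition projector :: "complex ^ ('a ^ 'n) ^ ('a ^ 'n)" where
  "projector = (\<chi> y x. if x \<in> euclidean_dual C \<and> y - x \<in> C then 1 / of_nat (card C) else 0)"

text \<open>The unnormalized indicator function of the coset of \<open>w\<close>.\<close>

definition coset_vector :: "'a ^ 'n \<Rightarrow> complex ^ ('a ^ 'n)" where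
  "coset_vector w = (\<chi> y. if y - w \<in> C then 1 else 0)"

text \<open>Self-orthogonality makes the phase of the product trivial, so operators with phase
  exponent 0 are closed under multiplication and commute.\<close>

lemma stabilizer_mult:
  assumes "a \<in> C" "b \<in> C" "a' \<in> C" "b' \<in> C"
  shows "error 0 a b ** error 0 a' b' = error 0 (a + a') (b + b')"
proof -
  have "scalar_product b a' = 0"
    using assms scalar_product_C_dual self_orthogonal by blast
  thus ?thesis
    using add_char_0[OF card_field]
    by (auto simp: error_mult[OF card_field] vec_eq_iff error_nth[OF card_field] add_char_def)
qed

lemma monoid_error_group: "monoid (error_group :: (complex ^ ('a ^ 'n) ^ ('a ^ 'n)) monoid)"
proof (rule monoidI)
  show "\<one>\<^bsub>error_group\<^esub> \<in> carrier (error_group :: (complex ^ ('a ^ 'n) ^ ('a ^ 'n)) monoid)"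
    unfolding error_group_def by (auto simp flip: error_0[OF card_field])
qed (auto simp: error_group_def matrix_mul_assoc error_mult[OF card_field], blast)

lemma stabilizer_left_inverse:
  "a \<in> C \<Longrightarrow> b \<in> C \<Longrightarrow> error 0 (- a) (- b) ** error 0 a b = mat 1"
  "a \<in> C \<Longrightarrow> b \<in> C \<Longrightarrow> error 0 a b ** error 0 (- a) (- b) = mat 1"
  by (simp_all add: stabilizer_mult uminus_C error_0[OF card_field])

lemma stabilizer_inverse:
  assumes "a \<in> C" "b \<in> C"
  shows "inv\<^bsub>error_group\<^esub> (error 0 a b) = error 0 (- a) (- b)"
  using assms stabilizer_left_inverse
  by (intro monoid.inv_unique'[OF monoid_error_group, symmetric]) (auto simp: error_group_def)

lemma mat_1_stabilizer: "mat 1 \<in> stabilizer"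
  unfolding stabilizer_def using zero_C error_0[OF card_field] by (metis (mono_tags, lifting) mem_Collect_eq)

lemma mult_stabilizer: "A \<in> stabilizer \<Longrightarrow> B \<in> stabilizer \<Longrightarrow> A ** B \<in> stabilizer"
  by (auto simp: stabilizer_def stabilizer_mult) (use add_C in blast)

lemma subgroup_stabilizer: "subgroup stabilizer error_group"
proof
  show "stabilizer \<subseteq> carrier error_group"
    by (auto simp: stabilizer_def error_group_def)
next
  fix E :: "complex ^ ('a ^ 'n) ^ ('a ^ 'n)"
  assume "E \<in> stabilizer"
  thus "inv\<^bsub>error_group\<^esub> E \<in> stabilizer"
    by (auto simp: stabilizer_def stabilizer_inverse) (use uminus_C in blast)
qed (use mat_1_stabilizer mult_stabilizer in \<open>auto simp: error_group_def\<close>)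

lemma comm_group_stabilizer: "comm_group (error_group\<lparr>carrier := stabilizer\<rparr>)"
proof (rule comm_groupI)
  fix A B assume "A \<in> carrier (error_group\<lparr>carrier := stabilizer\<rparr>)"
    "B \<in> carrier (error_group\<lparr>carrier := stabilizer\<rparr>)"
  thus "A \<otimes>\<^bsub>error_group\<lparr>carrier := stabilizer\<rparr>\<^esub> B = B \<otimes>\<^bsub>error_group\<lparr>carrier := stabilizer\<rparr>\<^esub> A"
    by (auto simp: error_group_def stabilizer_def stabilizer_mult add.commute)
next
  fix A assume "A \<in> carrier (error_group\<lparr>carrier := stabilizer\<rparr>)"
  then obtain a b where ab: "a \<in> C" "b \<in> C" "A = error 0 a b"
    by (auto simp: stabilizer_def)
  thus "\<exists>B\<in>carrier (error_group\<lparr>carrier := stabilizer\<rparr>).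
      B \<otimes>\<^bsub>error_group\<lparr>carrier := stabilizer\<rparr>\<^esub> A = \<one>\<^bsub>error_group\<lparr>carrier := stabilizer\<rparr>\<^esub>"
    using stabilizer_left_inverse(1)[OF ab(1,2)] uminus_C
    by (intro bexI[of _ "error 0 (- a) (- b)"]) (auto simp: error_group_def stabilizer_def)
qed (use mat_1_stabilizer mult_stabilizer in \<open>auto simp: error_group_def matrix_mul_assoc\<close>)

text \<open>With \<open>a = 0\<close>, the value at a point outside the dual is fixed by a
  nontrivial phase and so is 0; with \<open>b = 0\<close>, the operators are the translations by
  \<open>C\<close>.\<close>

lemma joint_eigenspace_stabilizer: "joint_eigenspace stabilizer = quantum_code"
proof (intro equalityI subsetI)
  fix \<psi> assume \<psi>: "\<psi> \<in> joint_eigenspace stabilizer"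
  have *: "add_char (scalar_product b (y - a)) * \<psi> $ (y - a) = \<psi> $ y" if "a \<in> C" "b \<in> C" for a b y
  proof -
    have "error 0 a b *v \<psi> = \<psi>"
      using that \<psi> by (auto simp: joint_eigenspace_def stabilizer_def)
    thus ?thesis
      using error_mult_vec_nth[OF card_field, of 0 a b \<psi> y] by simp
  qed
  show "\<psi> \<in> quantum_code"
    unfolding quantum_code_def
  proof (intro CollectI conjI allI impI ballI)
    fix y assume "y \<notin> euclidean_dual C"
    then obtain b where "b \<in> C" "add_char (scalar_product b y) \<noteq> 1"
      using ex_scalar_product_add_char[OF card_field _ scale_C] by blast
    thus "\<psi> $ y = 0"
      using *[OF zero_C, of b y] by simp
  next
    fix y a assume "a \<in> C"
    thus "\<psi> $ (y - a) = \<psi> $ y"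
      using *[OF _ zero_C, of a y] by (simp add: add_char_0[OF card_field])
  qed
next
  fix \<psi> assume \<psi>: "\<psi> \<in> quantum_code"
  have "add_char (scalar_product b (y - a)) * \<psi> $ (y - a) = \<psi> $ y" if "a \<in> C" "b \<in> C" for a b y
    using \<psi> that scalar_product_C_dual[of b "y - a"] add_char_0[OF card_field]
    by (cases "y \<in> euclidean_dual C") (auto simp: quantum_code_def dual_diff_C_iff)
  hence "error 0 a b *v \<psi> = \<psi>" if "a \<in> C" "b \<in> C" for a b
    using that by (simp add: vec_eq_iff error_mult_vec_nth[OF card_field])
  thus "\<psi> \<in> joint_eigenspace stabilizer"
    by (auto simp: joint_eigenspace_def stabilizer_def)
qed

section \<open>The orthogonal projector onto the code\<close>

lemma projector_mult_vec_nth: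
  "(projector *v \<psi>) $ y = (\<Sum>x | x \<in> euclidean_dual C \<and> y - x \<in> C. \<psi> $ x) / of_nat (card C)"
proof -
  have "(projector *v \<psi>) $ y =
      (\<Sum>x\<in>UNIV. if x \<in> euclidean_dual C \<and> y - x \<in> C then \<psi> $ x / of_nat (card C) else 0)"
    unfolding matrix_vector_mult_def projector_def by (auto intro!: sum.cong)
  also have "\<dots> = (\<Sum>x | x \<in> euclidean_dual C \<and> y - x \<in> C. \<psi> $ x / of_nat (card C))"
    by (subst sum.inter_filter[symmetric]) auto
  finally show ?thesis
    by (simp add: sum_divide_distrib)
qed

lemma projector_in_quantum_code: "projector *v \<psi> \<in> quantum_code"
proof -
  have "(projector *v \<psi>) $ y = 0" if "y \<notin> euclidean_dual C" for y
  proof -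
    have "{x. x \<in> euclidean_dual C \<and> y - x \<in> C} = {}"
      using that dual_diff_C_iff[of "y - _" y] by auto
    thus ?thesis
      unfolding projector_mult_vec_nth by (simp only: sum.empty div_0)
  qed
  moreover have "y - a - x \<in> C \<longleftrightarrow> y - x \<in> C" if "a \<in> C" for a x y
    using diff_C_iff[OF that, of "y - x"] by (simp add: algebra_simps)
  hence "(projector *v \<psi>) $ (y - a) = (projector *v \<psi>) $ y" if "a \<in> C" for a y
    using that by (simp add: projector_mult_vec_nth)
  ultimately show ?thesis
    by (simp add: quantum_code_def)
qed

lemma projector_quantum_code:
  assumes "\<psi> \<in> quantum_code"
  shows "projector *v \<psi> = \<psi>"
proof -
  have "(projector *v \<psi>) $ y = \<psi> $ y" for y
  proof (cases "y \<in> euclidean_dual C")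
    case False
    thus ?thesis
      using assms projector_in_quantum_code[of \<psi>] by (simp add: quantum_code_def)
  next
    case True
    have eq: "{x. x \<in> euclidean_dual C \<and> y - x \<in> C} = (\<lambda>a. y - a) ` C"
      using True by (force simp: dual_diff_C_iff)
    have "(\<Sum>x | x \<in> euclidean_dual C \<and> y - x \<in> C. \<psi> $ x) = (\<Sum>a\<in>C. \<psi> $ (y - a))"
      unfolding eq by (subst sum.reindex) (auto simp: inj_on_def)
    also have "\<dots> = of_nat (card C) * \<psi> $ y"
      using assms by (simp add: quantum_code_def)
    finally show ?thesis
      using zero_C by (auto simp: projector_mult_vec_nth)
  qed
  thus ?thesis
    by (simp add: vec_eq_iff)
qed

lemma is_orth_projector_projector: "is_orth_projector projector quantum_code"
  unfolding is_orth_projector_def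
proof (intro conjI)
  show "projector ** projector = projector"
    by (simp add: matrix_eq projector_quantum_code projector_in_quantum_code
        flip: matrix_vector_mul_assoc)
  have "x \<in> euclidean_dual C \<and> y - x \<in> C \<longleftrightarrow> y \<in> euclidean_dual C \<and> x - y \<in> C" for x y
    using dual_diff_C_iff[of "y - x" y] dual_diff_C_iff[of "x - y" x] uminus_C[of "x - y"]
      uminus_C[of "y - x"] by auto
  thus "conj_transpose projector = projector"
    by (simp add: conj_transpose_def projector_def vec_eq_iff)
  show "range ((*v) projector) = quantum_code"
    using projector_in_quantum_code projector_quantum_code by (auto simp: image_iff) metis
qed

lemma stabilizer_mult_projector: "M \<in> stabilizer \<Longrightarrow> M ** projector = projector"
  using projector_in_quantum_code joint_eigenspace_stabilizer
  by (auto simp: matrix_eq joint_eigenspace_def simp flip: matrix_vector_mul_assoc)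

text \<open>The shift by \<open>a\<close> keeps a column index in its coset, and the phase is 1 at
  indices in the dual, outside of which the columns of \<open>projector\<close> vanish.\<close>

lemma projector_mult_stabilizer:
  assumes "M \<in> stabilizer"
  shows "projector ** M = projector"
proof -
  obtain a b where ab: "a \<in> C" "b \<in> C" and M: "M = error 0 a b"
    using assms by (auto simp: stabilizer_def)
  have "y - (x + a) \<in> C \<longleftrightarrow> y - x \<in> C" for x y
    using diff_C_iff[OF ab(1), of "y - x"] by (simp add: algebra_simps)
  thus ?thesis
    using ab add_char_0[OF card_field]
    by (auto simp: M vec_eq_iff mult_error_nth[OF card_field] projector_def dual_add_C_iff
        scalar_product_C_dual)
qed

section \<open>Detectable and undetectable errors\<close>

lemma projector_error_projector_eq_0:
  assumes "a \<notin> euclidean_dual C \<or> b \<notin> euclidean_dual C"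
  shows "projector ** error c a b ** projector = 0"
proof -
  have "\<exists>a'\<in>C. \<exists>b'\<in>C. add_char (scalar_product b' a - scalar_product b a') \<noteq> 1"
  proof (cases "a \<in> euclidean_dual C")
    case False
    then obtain b' where "b' \<in> C" "add_char (scalar_product b' a) \<noteq> 1"
      using ex_scalar_product_add_char[OF card_field _ scale_C] by blast
    thus ?thesis
      using zero_C by (intro bexI[of _ 0] bexI[of _ b']) auto
  next
    case True
    with assms obtain a' where "a' \<in> C" "add_char (scalar_product a' b) \<noteq> 1"
      using ex_scalar_product_add_char[OF card_field _ scale_C] by blast
    \<comment> \<open>The negated witness makes up for the minus sign before
      \<open>scalar_product b a'\<close>.\<close>
    thus ?thesis
      using zero_C uminus_C
      by (intro bexI[of _ "- a'"] bexI[of _ 0])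
        (auto simp: scalar_product_linear scalar_product_commute[of b])
  qed
  then obtain a' b' where ab': "a' \<in> C" "b' \<in> C"
    and \<omega>: "add_char (scalar_product b' a - scalar_product b a') \<noteq> 1" (is "?\<omega> \<noteq> 1")
    by blast
  define M where "M = error 0 a' b'"
  define E where "E = error c a b"
  have M: "M \<in> stabilizer"
    using ab' by (auto simp: M_def stabilizer_def)
  \<comment> \<open>The left projector emits \<open>M\<close>, which moves past \<open>E\<close> at
    the cost of the phase and is absorbed by the right projector; a matrix equal to
    \<open>?\<omega>\<close> times itself is 0.\<close>
  have "projector ** E ** projector = projector ** (M ** E) ** projector"
    by (simp add: matrix_mul_assoc projector_mult_stabilizer[OF M])
  also have "M ** E = mat ?\<omega> ** (E ** M)"
    unfolding M_def E_def by (rule error_commute[OF card_field])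
  also have "projector ** (mat ?\<omega> ** (E ** M)) ** projector =
      mat ?\<omega> ** (projector ** E ** (M ** projector))"
    by (simp add: mult_mat_commute flip: matrix_mul_assoc)
  finally have "projector ** E ** projector = mat ?\<omega> ** (projector ** E ** projector)"
    by (simp only: stabilizer_mult_projector[OF M])
  hence "(projector ** E ** projector) $ y $ x = ?\<omega> * (projector ** E ** projector) $ y $ x" for x y
    by (metis mat_mult_nth)
  hence "(projector ** E ** projector) $ y $ x = 0" for x y
    using \<omega> by (metis mult_cancel_right1)
  thus ?thesis
    unfolding E_def by (simp add: vec_eq_iff)
qed

text \<open>If both words lie in \<open>C\<close>, the error is a scalar times a stabilizer element;
  otherwise one of them lies outside the dual and the scalar is 0.\<close>

lemma detectable_error:
  assumes "a \<in> euclidean_dual C \<Longrightarrow> a \<in> C" and "b \<in> euclidean_dual C \<Longrightarrow> b \<in> C"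
  shows "detectable quantum_code (error c a b)"
proof (cases "a \<in> euclidean_dual C \<and> b \<in> euclidean_dual C")
  case True
  hence "error 0 a b \<in> stabilizer"
    using assms by (auto simp: stabilizer_def)
  moreover have "error c a b = mat (zeta TYPE('a) ^ c) ** error 0 a b"
    by (simp add: vec_eq_iff mat_mult_nth error_nth[OF card_field])
  ultimately have "projector ** error c a b ** projector = mat (zeta TYPE('a) ^ c) ** projector"
    using is_orth_projector_projector
    by (simp add: mult_mat_commute projector_mult_stabilizer is_orth_projector_def
        flip: matrix_mul_assoc)
  thus ?thesis
    using is_orth_projector_projector by (auto simp: detectable_def)
next
  case False
  hence "projector ** error c a b ** projector = 0"
    using projector_error_projector_eq_0 by blast
  also have "0 = mat 0 ** projector"
    by (simp add: vec_eq_iff mat_mult_nth)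
  finally show ?thesis
    using is_orth_projector_projector unfolding detectable_def by blast
qed

lemma coset_vector_in_quantum_code:
  assumes "w \<in> euclidean_dual C"
  shows "coset_vector w \<in> quantum_code"
proof -
  have "y \<in> euclidean_dual C" if "y - w \<in> C" for y
    using that assms self_orthogonal dual_add[of "y - w" w] by auto
  moreover have "y - a - w \<in> C \<longleftrightarrow> y - w \<in> C" if "a \<in> C" for a y
    using diff_C_iff[OF that, of "y - w"] by (simp add: algebra_simps)
  ultimately show ?thesis
    by (auto simp: quantum_code_def coset_vector_def)
qed

text \<open>The shift by \<open>w\<close> takes the code vector \<open>coset_vector 0\<close> to the
  code vector \<open>coset_vector w\<close>, which is not a multiple of it.\<close>

lemma not_detectable_error:
  assumes "w \<in> euclidean_dual C" "w \<notin> C"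
  shows "\<not> detectable quantum_code (error 0 w 0)"
proof
  assume "detectable quantum_code (error 0 w 0)"
  then obtain P c where P: "is_orth_projector P quantum_code"
    and eq: "P ** error 0 w 0 ** P = mat c ** P"
    by (auto simp: detectable_def)
  \<comment> \<open>\<open>P\<close> is whichever projector witnesses \<open>detectable\<close>;
    idempotence and its range force it to fix the code.\<close>
  have fix_P: "P *v \<psi> = \<psi>" if "\<psi> \<in> quantum_code" for \<psi>
  proof -
    have "\<psi> \<in> range ((*v) P)"
      using that P by (simp add: is_orth_projector_def)
    then obtain \<phi> where \<phi>: "\<psi> = P *v \<phi>"
      by (rule rangeE)
    have "P ** P = P"
      using P by (simp add: is_orth_projector_def)
    thus ?thesis
      by (simp add: \<phi> matrix_vector_mul_assoc)
  qed
  have "0 \<in> euclidean_dual C"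
    using zero_C self_orthogonal by auto
  hence 0: "P *v coset_vector 0 = coset_vector 0"
    by (intro fix_P coset_vector_in_quantum_code)
  have "error 0 w 0 *v coset_vector 0 = coset_vector w"
    by (simp add: vec_eq_iff error_mult_vec_nth[OF card_field] coset_vector_def
        add_char_0[OF card_field])
  hence "(P ** error 0 w 0 ** P) *v coset_vector 0 = coset_vector w"
    using assms(1) by (simp add: 0 fix_P coset_vector_in_quantum_code flip: matrix_vector_mul_assoc)
  hence "coset_vector w = c *s coset_vector 0"
    by (simp add: eq 0 mat_mult_vec flip: matrix_vector_mul_assoc)
  hence "coset_vector w $ w = c * coset_vector 0 $ w"
    by simp
  thus False
    using assms zero_C by (simp add: coset_vector_def)
qed

section \<open>Dimension and minimum distance\<close>

lemma coset_vector_eq_iff: "coset_vector v = coset_vector w \<longleftrightarrow> v - w \<in> C"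
proof
  assume "coset_vector v = coset_vector w"
  hence "coset_vector v $ v = coset_vector w $ v" by simp
  thus "v - w \<in> C"
    using zero_C by (simp add: coset_vector_def split: if_splits)
next
  assume "v - w \<in> C"
  hence "y - v \<in> C \<longleftrightarrow> y - w \<in> C" for y
    using diff_C_iff[of "v - w" "y - w"] by simp
  thus "coset_vector v = coset_vector w"
    by (simp add: coset_vector_def)
qed

text \<open>The coset vectors of words in the dual form a basis, and each of them comes from
  \<open>card C\<close> words.\<close>

lemma dim_quantum_code: "vec.dim quantum_code * card C = card (euclidean_dual C)"
proof -
  define B where "B = coset_vector ` euclidean_dual C"
  have fin: "finite B" by (simp add: B_def)
  have "B \<subseteq> quantum_code"
    using coset_vector_in_quantum_code by (auto simp: B_def)
  moreover have "quantum_code \<subseteq> vec.span B"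
  proof
    fix \<psi> assume \<psi>: "\<psi> \<in> quantum_code"
    \<comment> \<open>The sum meets each coset once per representative, hence the division by
      \<open>card C\<close>; it is the coset average that \<open>projector\<close> computes.\<close>
    have "(\<Sum>w\<in>euclidean_dual C. (\<psi> $ w / of_nat (card C)) *s coset_vector w) $ y = (projector *v \<psi>) $ y"
      for y
    proof -
      have "(\<Sum>w\<in>euclidean_dual C. (\<psi> $ w / of_nat (card C)) *s coset_vector w) $ y =
          (\<Sum>w\<in>euclidean_dual C. if y - w \<in> C then \<psi> $ w / of_nat (card C) else 0)"
        by (auto simp: coset_vector_def intro!: sum.cong)
      also have "\<dots> = (\<Sum>w | w \<in> euclidean_dual C \<and> y - w \<in> C. \<psi> $ w / of_nat (card C))"
        by (subst sum.inter_filter[symmetric]) auto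
      finally show ?thesis
        by (simp add: projector_mult_vec_nth sum_divide_distrib)
    qed
    hence "\<psi> = (\<Sum>w\<in>euclidean_dual C. (\<psi> $ w / of_nat (card C)) *s coset_vector w)"
      by (simp add: vec_eq_iff projector_quantum_code[OF \<psi>])
    also have "\<dots> \<in> vec.span B"
      by (intro vec.span_sum vec.span_scale vec.span_base) (auto simp: B_def)
    finally show "\<psi> \<in> vec.span B" .
  qed
  moreover have "vec.independent B"
  proof (rule vec.independent_if_scalars_zero[OF fin])
    fix u v assume sum: "(\<Sum>v\<in>B. u v *s v) = 0" and "v \<in> B"
    then obtain w where w: "w \<in> euclidean_dual C" "v = coset_vector w"
      by (auto simp: B_def)
    \<comment> \<open>Distinct cosets are disjoint, so evaluation at \<open>w\<close> isolates the
      coefficient of \<open>v\<close>.\<close>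
    have "x $ w = (if x = v then 1 else 0)" if "x \<in> B" for x
    proof -
      obtain z where "x = coset_vector z"
        using \<open>x \<in> B\<close> unfolding B_def by blast
      thus ?thesis
        using coset_vector_eq_iff[of w z] by (auto simp: w coset_vector_def)
    qed
    hence "(\<Sum>x\<in>B. u x *s x) $ w = (\<Sum>x\<in>B. if x = v then u v else 0)"
      by (auto intro!: sum.cong)
    thus "u v = 0"
      using sum fin \<open>v \<in> B\<close> by simp
  qed
  ultimately have "vec.dim quantum_code = card B"
    by (intro vec.dim_unique[of B]) auto
  moreover have "card {w \<in> euclidean_dual C. coset_vector w = v} = card C" if v: "v \<in> B" for v
  proof -
    obtain z where z: "z \<in> euclidean_dual C" "v = coset_vector z"
      using v by (auto simp: B_def)
    have "{w \<in> euclidean_dual C. coset_vector w = v} = (\<lambda>a. z + a) ` C"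
    proof (intro equalityI subsetI)
      fix w assume "w \<in> {w \<in> euclidean_dual C. coset_vector w = v}"
      hence "w - z \<in> C"
        by (simp add: z(2) coset_vector_eq_iff)
      thus "w \<in> (\<lambda>a. z + a) ` C"
        by (intro image_eqI[of _ _ "w - z"]) auto
    qed (use z(1) in \<open>auto simp: z(2) coset_vector_eq_iff dual_add_C_iff\<close>)
    thus ?thesis
      by (simp add: card_image)
  qed
  hence "card (euclidean_dual C) = card B * card C"
    using sum.group[of "euclidean_dual C" B coset_vector "\<lambda>_. 1 :: nat"] fin
    by (simp add: B_def)
  ultimately show ?thesis by simp
qed

text \<open>The dual has \<open>CARD('a) ^ (k + m)\<close> words, so the index of \<open>C\<close>
  in it is \<open>CARD('a) ^ m\<close>. As \<open>m > 0\<close>, some word lies in the dual but not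
  in \<open>C\<close>, and the minimum weight is attained.\<close>

theorem is_quantum_stabilizer_code_quantum_code:
  assumes card: "card C = CARD('a) ^ k" and n: "CARD('n) = 2 * k + m" and "m > 0"
  shows "is_quantum_stabilizer_code CARD('n) m (wt (euclidean_dual C - C)) CARD('a) quantum_code"
proof -
  define q where "q = CARD('a)"
  have "card {0, 1 :: 'a} \<le> q"
    unfolding q_def by (intro card_mono) auto
  hence q: "q > 1" by simp
  have "q ^ k * card (euclidean_dual C) = q ^ k * q ^ (k + m)"
    using card_mult_card_dual by (simp add: card n q_def mult_2 power_add mult.assoc)
  hence dual: "card (euclidean_dual C) = q ^ (k + m)"
    using q by simp
  have "vec.dim quantum_code * q ^ k = q ^ m * q ^ k"
    using dim_quantum_code by (simp add: dual card q_def power_add mult_ac)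
  hence dim: "vec.dim quantum_code = q ^ m"
    using q by simp
  have "card C < card (euclidean_dual C)"
    using q \<open>m > 0\<close> by (simp add: card dual flip: q_def)
  hence "euclidean_dual C \<noteq> C" by auto
  hence ne: "euclidean_dual C - C \<noteq> {}"
    using self_orthogonal by auto
  have wt_eq: "wt (euclidean_dual C - C) = Min (hamming_weight ` (euclidean_dual C - C))"
    using zero_C by (simp add: wt_def)
  have wt_le: "wt (euclidean_dual C - C) \<le> hamming_weight w" if "w \<in> euclidean_dual C - C" for w
    unfolding wt_eq using that by (intro Min_le) auto
  obtain w where w: "w \<in> euclidean_dual C - C" "hamming_weight w = wt (euclidean_dual C - C)"
    using Min_in[of "hamming_weight ` (euclidean_dual C - C)"] ne unfolding wt_eq by fastforce
  have weight: "hamming_weight a \<le> error_weight a b" "hamming_weight b \<le> error_weight a b" for a b :: "'a ^ 'n"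
    by (auto simp: hamming_weight_def error_weight_def intro!: card_mono)
  have "has_min_distance quantum_code (wt (euclidean_dual C - C))"
    unfolding has_min_distance_def detects_below_def
  proof (intro conjI allI impI)
    fix c and a b :: "'a ^ 'n" assume "error_weight a b < wt (euclidean_dual C - C)"
    hence "a \<notin> euclidean_dual C - C" "b \<notin> euclidean_dual C - C"
      using wt_le[of a] wt_le[of b] weight(1)[of a b] weight(2)[of b a] by auto
    thus "detectable quantum_code (error c a b)"
      by (intro detectable_error) auto
  next
    fix d assume d: "\<forall>c a b. error_weight a b < d \<longrightarrow> detectable quantum_code (error c a b)"
    \<comment> \<open>The pure shift by a word of minimum weight is undetectable and has that same
      weight.\<close>
    have "error_weight w 0 = hamming_weight w"
      by (simp add: error_weight_def hamming_weight_def)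
    thus "d \<le> wt (euclidean_dual C - C)"
      using d not_detectable_error[of w] w by (metis DiffD1 DiffD2 not_le)
  qed
  moreover have "is_stabilizer_code quantum_code"
  proof -
    have "quantum_code \<noteq> {0}"
    proof
      assume "quantum_code = {0}"
      hence "vec.dim quantum_code = 0"
        by simp
      with dim q show False by simp
    qed
    thus ?thesis
      using subgroup_stabilizer comm_group_stabilizer joint_eigenspace_stabilizer
      unfolding is_stabilizer_code_def by (intro exI[of _ stabilizer]) simp
  qed
  ultimately show ?thesis
    using dim by (simp add: is_quantum_stabilizer_code_def q_def)
qed

end

section \<open>Weighted evaluations at the roots of a polynomial\<close>

text \<open>If \<open>r\<close> were also a root of the cofactor, all roots of \<open>g\<close>
  would be roots of \<open>q\<close>, whose degree is too small. The product rule identifies the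
  value of \<open>q\<close> at \<open>r\<close>.\<close>

lemma separable_cofactor:
  fixes g :: "'a::field poly"
  assumes roots: "card {x. poly g x = 0} = degree g" and root: "poly g r = 0" and "g \<noteq> 0"
  obtains q where "g = [:- r, 1:] * q" and "poly q r = poly (pderiv g) r" and "poly (pderiv g) r \<noteq> 0"
    and "Suc (degree q) = degree g" and "lead_coeff q = lead_coeff g"
proof -
  obtain q where q: "g = [:- r, 1:] * q"
    using root by (auto simp: poly_eq_0_iff_dvd dvd_def)
  with \<open>g \<noteq> 0\<close> have "q \<noteq> 0" by auto
  have deg: "Suc (degree q) = degree g"
    using \<open>q \<noteq> 0\<close> by (simp add: q degree_mult_eq del: mult_pCons_left)
  have lead: "lead_coeff q = lead_coeff g"
    by (simp add: q lead_coeff_mult del: mult_pCons_left)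
  have der: "poly q r = poly (pderiv g) r"
    by (simp add: q pderiv_mult pderiv_pCons del: mult_pCons_left)
  have "poly q r \<noteq> 0"
  proof
    assume "poly q r = 0"
    hence "{x. poly g x = 0} \<subseteq> {x. poly q x = 0}"
      by (auto simp: q)
    hence "degree g \<le> card {x. poly q x = 0}"
      unfolding roots[symmetric] using poly_roots_finite[OF \<open>q \<noteq> 0\<close>] by (rule card_mono[rotated])
    also have "\<dots> \<le> degree q"
      by (rule card_poly_roots_bound[OF \<open>q \<noteq> 0\<close>])
    finally show False
      using deg by simp
  qed
  with q der deg lead show ?thesis
    by (intro that) auto
qed

text \<open>The left-hand side times the leading coefficient of \<open>g\<close> is the coefficient of degree
  \<open>degree g - 1\<close> of the polynomial that interpolates \<open>f\<close> at the roots, i.e. of \<open>f\<close> itself.\<close>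

lemma sum_roots_div_pderiv_eq_0:
  fixes f g :: "'a::field poly"
  assumes roots: "card {x. poly g x = 0} = degree g" and deg: "Suc (degree f) < degree g"
  shows "(\<Sum>x | poly g x = 0. poly f x / poly (pderiv g) x) = 0"
proof -
  define R where "R = {x. poly g x = 0}"
  have "g \<noteq> 0"
    using deg by auto
  hence fin: "finite R"
    unfolding R_def by (rule poly_roots_finite)
  have "\<exists>q. g = [:- r, 1:] * q \<and> poly q r = poly (pderiv g) r \<and> poly (pderiv g) r \<noteq> 0 \<and>
      Suc (degree q) = degree g \<and> lead_coeff q = lead_coeff g" if "r \<in> R" for r
    using separable_cofactor[OF roots _ \<open>g \<noteq> 0\<close>, of r] that unfolding R_def by blast
  then obtain q where q: "g = [:- r, 1:] * q r" "poly (q r) r = poly (pderiv g) r"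
      "poly (pderiv g) r \<noteq> 0" "Suc (degree (q r)) = degree g" "lead_coeff (q r) = lead_coeff g"
    if "r \<in> R" for r
    by metis
  \<comment> \<open>The Lagrange interpolation polynomial: \<open>q r\<close> vanishes at all roots
    of \<open>g\<close> except \<open>r\<close>.\<close>
  define L where "L = (\<Sum>r\<in>R. smult (poly f r / poly (pderiv g) r) (q r))"
  have "poly L x = poly f x" if x: "x \<in> R" for x
  proof -
    have "poly (q r) x = (if r = x then poly (pderiv g) x else 0)" if r: "r \<in> R" for r
    proof (cases "r = x")
      case False
      have "poly g x = (x - r) * poly (q r) x"
        by (subst q(1)[OF r]) (simp add: left_diff_distrib)
      thus ?thesis
        using False x by (auto simp: R_def)
    qed (use q(2)[OF r] in simp)
    hence "poly L x = (\<Sum>r\<in>R. if r = x then poly f x else 0)"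
      using q(3)[OF x] by (auto simp: L_def poly_sum intro!: sum.cong)
    thus ?thesis
      using x fin by simp
  qed
  moreover have "degree L \<le> degree g - 1"
    unfolding L_def
  proof (intro degree_sum_le fin)
    fix r assume "r \<in> R"
    thus "degree (smult (poly f r / poly (pderiv g) r) (q r)) \<le> degree g - 1"
      using q(4)[of r] degree_smult_le[of "poly f r / poly (pderiv g) r" "q r"] by linarith
  qed
  hence "degree L < card R"
    using deg by (simp add: R_def roots)
  ultimately have "L = f"
    using deg by (intro poly_eqI_degree[of R]) (auto simp: R_def roots)
  \<comment> \<open>The degree of \<open>f\<close> is strictly below \<open>degree g - 1\<close>,
    the exact degree of every \<open>q r\<close>.\<close>
  hence "0 = coeff L (degree g - 1)"
    using deg by (simp add: coeff_eq_0)
  also have "\<dots> = (\<Sum>r\<in>R. poly f r / poly (pderiv g) r * lead_coeff g)"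
    unfolding L_def coeff_sum coeff_smult
  proof (intro sum.cong refl)
    fix r assume r: "r \<in> R"
    have "coeff (q r) (degree g - 1) = lead_coeff g"
      using q(4)[OF r] q(5)[OF r] by (metis diff_Suc_1)
    thus "poly f r / poly (pderiv g) r * coeff (q r) (degree g - 1) =
        poly f r / poly (pderiv g) r * lead_coeff g"
      by simp
  qed
  also have "\<dots> = (\<Sum>r\<in>R. poly f r / poly (pderiv g) r) * lead_coeff g"
    by (rule sum_distrib_right[symmetric])
  finally show ?thesis
    using \<open>g \<noteq> 0\<close> by (simp add: R_def)
qed

text \<open>At the roots of \<open>g\<close> the polynomial \<open>P\<close> takes the values \<open>- c / x\<close>. In the product of two
  twisted polynomials, characteristic 2 cancels the contribution \<open>2 f\<^sub>0 f'\<^sub>0 \<eta> P\<close>, and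
  \<open>P\<^sup>2 = x P V\<close> reduces to \<open>- c V\<close>, of degree at most \<open>degree g - 2\<close>.\<close>

lemma sum_roots_twisted_div_pderiv_eq_0:
  fixes g P V :: "'a::field poly"
  assumes two: "(2 :: 'a) = 0"
    and roots: "card {x. poly g x = 0} = degree g"
    and deg_g: "degree g = 2 * k + 1"
    and g: "g = [:0, 1:] * P + [:c:]"
    and P: "P = [:0, 1:] * V"
    and deg: "degree (pCons f0 t) < k" "degree (pCons f0' t') < k"
  shows "(\<Sum>x | poly g x = 0. poly (pCons f0 t + smult (f0 * \<eta>) P) x *
      poly (pCons f0' t' + smult (f0' * \<eta>) P) x / poly (pderiv g) x) = 0"
proof -
  \<comment> \<open>In the mixed terms, \<open>x * P\<close> becomes \<open>- c\<close>, so that a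
    factor \<open>x\<close> of \<open>x * t\<close> or \<open>x * t'\<close> cancels and the degree
    stays small.\<close>
  define R where "R = pCons f0 t * pCons f0' t' - smult (\<eta> * c) (smult f0 t' + smult f0' t)
      - smult (f0 * f0' * \<eta>\<^sup>2 * c) V"
  have "degree g = Suc (degree P)" if "P \<noteq> 0"
    using that by (simp add: g degree_pCons_eq)
  hence "P \<noteq> 0 \<Longrightarrow> degree P = 2 * k"
    using deg_g by simp
  moreover have "degree P = Suc (degree V)" if "V \<noteq> 0"
    using that by (simp add: P degree_pCons_eq)
  ultimately have "degree V < 2 * k"
    using deg(1) by (cases "V = 0") (auto simp: P)
  moreover have "degree (pCons f0 t * pCons f0' t') < 2 * k"
    using degree_mult_le[of "pCons f0 t" "pCons f0' t'"] deg by linarith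
  moreover have "degree t < k" "degree t' < k"
    using deg by (auto simp: degree_pCons_eq_if split: if_splits)
  ultimately have "degree R < 2 * k"
    unfolding R_def
    by (intro degree_diff_less le_less_trans[OF degree_smult_le] degree_add_less) auto
  have "poly (pCons f0 t + smult (f0 * \<eta>) P) x * poly (pCons f0' t' + smult (f0' * \<eta>) P) x = poly R x"
    if x: "poly g x = 0" for x
  proof -
    have xP: "x * poly P x = - c"
      using x by (simp add: g add_eq_0_iff2)
    have "poly P x * poly P x = (x * poly P x) * poly V x"
      by (simp add: P mult_ac)
    hence PP: "poly P x * poly P x = - c * poly V x"
      by (simp only: xP)
    have "poly (pCons f0 t + smult (f0 * \<eta>) P) x * poly (pCons f0' t' + smult (f0' * \<eta>) P) x
        = poly (pCons f0 t * pCons f0' t') x + 2 * (f0 * f0' * \<eta> * poly P x)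
          + (x * poly P x) * \<eta> * (f0 * poly t' x + f0' * poly t x)
          + f0 * f0' * \<eta>\<^sup>2 * (poly P x * poly P x)"
      by (simp add: algebra_simps power2_eq_square)
    also have "\<dots> = poly R x"
      unfolding xP PP two R_def by (simp add: algebra_simps)
    finally show ?thesis .
  qed
  hence "(\<Sum>x | poly g x = 0. poly (pCons f0 t + smult (f0 * \<eta>) P) x *
      poly (pCons f0' t' + smult (f0' * \<eta>) P) x / poly (pderiv g) x) =
      (\<Sum>x | poly g x = 0. poly R x / poly (pderiv g) x)"
    by (intro sum.cong) auto
  also have "\<dots> = 0"
    using roots \<open>degree R < 2 * k\<close> deg_g by (intro sum_roots_div_pderiv_eq_0) auto
  finally show ?thesis .
qed

text \<open>An even power of \<open>- 1\<close> is 1, but its power to the field order is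
  \<open>- 1\<close>.\<close>

lemma CHAR_eq_2_if_CARD:
  assumes "CARD('a::finite_field) = 2 ^ h" and "h > 0"
  shows "CHAR('a) = 2"
proof -
  have "(- 1 :: 'a) ^ 2 ^ h = - 1"
    using finite_field_power_card_eq_same[of "- 1 :: 'a"] by (simp only: assms(1))
  hence "(1 :: 'a) = - 1"
    using assms(2) by simp
  hence "of_nat 2 = (0 :: 'a)"
    by (simp add: eq_neg_iff_add_eq_0)
  hence "CHAR('a) dvd 2"
    by (simp only: of_nat_eq_0_iff_char_dvd)
  thus ?thesis
    using primes_dvd_imp_eq[OF CHAR_prime two_is_prime_nat] by blast
qed

text \<open>Only even \<open>i\<close> contribute to the derivative, and \<open>a ^ 2 ^ (h - 1)\<close> is the square root of \<open>a\<close>.\<close>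

lemma poly_pderiv_eq_square:
  fixes a :: "nat \<Rightarrow> 'a::finite_field"
  assumes card: "CARD('a) = 2 ^ h" and "h > 0"
    and g: "g = monom 1 (4 * m + 1) + (\<Sum>i = 1..2 * m. monom (a i) (4 * m + 1 - i)) + [:c:]"
  shows "poly (pderiv g) x =
    (x ^ (2 * m) + (\<Sum>j = 1..m. a (2 * j) ^ (2 ^ (h - 1)) * x ^ (2 * m - j)))\<^sup>2"
proof -
  have char: "CHAR('a) = 2"
    using assms(1,2) by (rule CHAR_eq_2_if_CARD)
  have of_nat: "(of_nat n :: 'a) = (if even n then 0 else 1)" for n
    using of_nat_eq_iff_cong_CHAR[where 'a = 'a, of n "n mod 2"]
    by (auto simp: char cong_def elim!: evenE oddE)
  have sqrt: "(y ^ (2 ^ (h - 1)))\<^sup>2 = y" for y :: 'a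
  proof -
    have "(y ^ (2 ^ (h - 1)))\<^sup>2 = y ^ 2 ^ Suc (h - 1)"
      by (simp add: mult.commute flip: power_mult)
    thus ?thesis
      using \<open>h > 0\<close> finite_field_power_card_eq_same[of y] by (simp add: card)
  qed
  have "poly (pderiv g) x = of_nat (4 * m + 1) * x ^ (4 * m) +
      (\<Sum>i = 1..2 * m. of_nat (4 * m + 1 - i) * a i * x ^ (4 * m + 1 - i - 1))"
    unfolding g by (simp add: pderiv_add higher_pderiv_sum[of 1, simplified] pderiv_monom pderiv_pCons
        poly_sum poly_monom)
  also have "of_nat (4 * m + 1) = (1 :: 'a)"
    by (subst of_nat) simp
  also have "(\<Sum>i = 1..2 * m. of_nat (4 * m + 1 - i) * a i * x ^ (4 * m + 1 - i - 1)) =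
      (\<Sum>i\<in>{i \<in> {1..2 * m}. even i}. a i * x ^ (4 * m - i))"
    unfolding sum.inter_filter[OF finite_atLeastAtMost]
    by (intro sum.cong) (auto simp: of_nat)
  also have "\<dots> = (\<Sum>j = 1..m. a (2 * j) * x ^ (4 * m - 2 * j))"
    by (rule sum.reindex_bij_witness[of _ "\<lambda>j. 2 * j" "\<lambda>i. i div 2"]) auto
  also have "1 * x ^ (4 * m) + \<dots> = (x ^ (2 * m))\<^sup>2 +
      (\<Sum>j = 1..m. (a (2 * j) ^ (2 ^ (h - 1)) * x ^ (2 * m - j))\<^sup>2)"
    unfolding power_mult_distrib sqrt
    by (simp add: diff_mult_distrib2 mult_ac flip: power_mult)
  also have "\<dots> = (x ^ (2 * m) + (\<Sum>j = 1..m. a (2 * j) ^ (2 ^ (h - 1)) * x ^ (2 * m - j)))\<^sup>2"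
    by (simp add: char freshmans_dream freshmans_dream_sum)
  finally show ?thesis .
qed

section \<open>The evaluation map\<close>

lemma ev_add: "ev \<alpha> v (f + g) = ev \<alpha> v f + ev \<alpha> v g"
  and ev_smult: "ev \<alpha> v (smult k f) = k *s ev \<alpha> v f"
  by (simp_all add: ev_def vec_eq_iff algebra_simps)

text \<open>Nonzero weights cancel, and the values at \<open>CARD('n)\<close> distinct points
  determine a polynomial of smaller degree.\<close>

lemma inj_on_ev:
  fixes \<alpha> v :: "'a::field ^ 'n"
  assumes "inj (($) \<alpha>)" and "\<And>i. v $ i \<noteq> 0"
  shows "inj_on (ev \<alpha> v) {f. degree f < CARD('n)}"
proof (rule inj_onI)
  fix f g assume deg: "f \<in> {f. degree f < CARD('n)}" "g \<in> {f. degree f < CARD('n)}"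
    and eq: "ev \<alpha> v f = ev \<alpha> v g"
  have "poly f (\<alpha> $ i) = poly g (\<alpha> $ i)" for i
    using eq assms(2)[of i] by (auto simp: ev_def vec_eq_iff)
  moreover have "card (range (($) \<alpha>)) = CARD('n)"
    using assms(1) by (simp add: card_image)
  ultimately show "f = g"
    using deg by (intro poly_eqI_degree[of "range (($) \<alpha>)"]) auto
qed

theorem proposition24:
  fixes s h t :: nat
    and F :: "'a::finite_field set"
    and a :: "nat \<Rightarrow> 'a"
    and c \<eta> :: 'a
    and g :: "'a poly"
    and \<alpha> v :: "'a ^ 'n"
    and S2 :: "'a poly set"
    and C2 :: "('a ^ 'n) set"
  assumes "s \<ge> 2" and "h \<ge> 1" and "t \<ge> 1" and "t dvd h"
    and "CARD('a) = 2 ^ h"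
    and "is_subfield F" and "card F = 2 ^ t"
    and "\<forall>i\<in>{1..2 ^ (s - 1)}. a i \<in> F \<and> a i \<noteq> 0"
    and "c \<in> F" and "c \<noteq> 0"
    and "g = monom 1 (2 ^ s + 1) + (\<Sum>i = 1..2 ^ (s - 1). monom (a i) (2 ^ s + 1 - i)) + [:c:]"
    and "is_splitting_field_over F g"
    and "CARD('n) = 2 ^ s + 1"
    and "range (($) \<alpha>) = {x. poly g x = 0}" and "inj (($) \<alpha>)"
    and "v = (\<chi> i. inverse ((\<alpha> $ i) ^ (2 ^ (s - 1)) +
               (\<Sum>j = 1..2 ^ (s - 2). a (2 * j) ^ (2 ^ (h - 1)) * (\<alpha> $ i) ^ (2 ^ (s - 1) - j))))"
    and "\<eta> \<noteq> 0"
    and "S2 = {(\<Sum>i<2 ^ (s - 1). monom (f i) i) +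
               smult (f 0 * \<eta>)
                 ((\<Sum>j = 1..2 ^ (s - 1). monom (a j) (2 ^ s - j)) + monom 1 (2 ^ s))
               | f :: nat \<Rightarrow> 'a. True}"
    and "C2 = ev \<alpha> v ` S2"
  shows "\<exists>Q :: (complex ^ ('a ^ 'n)) set.
           is_quantum_stabilizer_code (2 ^ s + 1) 1 (wt (euclidean_dual C2 - C2)) (2 ^ h) Q"
proof -
  \<comment> \<open>Thus \<open>2 ^ s = 4 * m\<close>, the form used for the derivative, and the
    length is \<open>2 * k + 1\<close>, where \<open>k\<close> will be the dimension of
    \<open>C2\<close>.\<close>
  define m k :: nat where "m = 2 ^ (s - 2)" and "k = 2 * m"
  obtain s' where s': "s = Suc (Suc s')"
    using \<open>s \<ge> 2\<close> by (metis Suc_le_D numeral_2_eq_2 Suc_le_mono)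
  have pow: "2 ^ s = 2 * k" "2 ^ (s - 1) = k" "2 ^ (s - 2) = m"
    by (simp_all add: m_def k_def s')
  have "m > 0"
    by (simp add: m_def)
  hence "k > 1"
    by (simp add: k_def)
  have char: "CHAR('a) = 2"
    using assms(5,2) by (intro CHAR_eq_2_if_CARD) auto
  hence two: "(2 :: 'a) = 0"
    using of_nat_CHAR[where 'a = 'a] by simp
  note g_eq = assms(11)[unfolded pow]

  \<comment> \<open>The twisting polynomial and the roots of \<open>g\<close>\<close>
  define P where "P = (\<Sum>j = 1..k. monom (a j) (2 * k - j)) + monom 1 (2 * k)"
  have g_P: "g = [:0, 1:] * P + [:c:]"
  proof -
    have *: "[:0, 1:] * monom y j = monom y (Suc j)" for y :: 'a and j
      by (simp add: monom_Suc)
    have "[:0, 1:] * P = (\<Sum>j = 1..k. monom (a j) (2 * k + 1 - j)) + monom 1 (2 * k + 1)"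
      unfolding P_def distrib_left sum_distrib_left * by (intro arg_cong2[of _ _ _ _ "(+)"] sum.cong)
        (auto simp: Suc_diff_le)
    thus ?thesis
      by (simp add: g_eq)
  qed
  \<comment> \<open>The lowest exponent in \<open>P\<close> is \<open>k\<close>, reached at
    \<open>j = k\<close>. Hence \<open>P\<close> is divisible by \<open>x\<close>, and the twist
    leaves the coefficients below \<open>k\<close> intact.\<close>
  have coeff_P: "coeff P i = 0" if "i < k" for i
    using that by (auto simp: P_def coeff_sum intro!: sum.neutral)
  have "coeff P 0 = 0"
    using coeff_P \<open>k > 1\<close> by simp
  then obtain V where V: "P = [:0, 1:] * V"
    by (cases P rule: pCons_cases) auto
  have deg_P: "degree P = 2 * k"
  proof (rule antisym)
    show "degree P \<le> 2 * k"
      unfolding P_def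
      by (intro degree_add_le degree_sum_le le_trans[OF degree_monom_le]) auto
    have "coeff P (2 * k) = 1"
      by (auto simp: P_def coeff_sum intro!: sum.neutral)
    thus "2 * k \<le> degree P"
      by (intro le_degree) simp
  qed
  have deg_g: "degree g = 2 * k + 1"
    using deg_P \<open>k > 1\<close> by (auto simp: g_P degree_pCons_eq_if)
  hence "g \<noteq> 0" by auto
  have card_n: "CARD('n) = 2 * k + 1"
    using assms(13) by (simp add: pow)
  have roots: "card {x. poly g x = 0} = degree g"
    using assms(15) card_n by (simp add: deg_g card_image flip: assms(14))
  have v_square: "v $ i * v $ i = inverse (poly (pderiv g) (\<alpha> $ i))" for i
    using poly_pderiv_eq_square[OF assms(5), of g m a c "\<alpha> $ i"] assms(2) g_eq
    by (simp only: assms(16) pow vec_lambda_beta k_def power2_eq_square inverse_mult_distrib) simp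
  \<comment> \<open>All roots are simple; this excludes the default \<open>inverse 0 = 0\<close> as
    an entry of \<open>v\<close>.\<close>
  have "poly (pderiv g) (\<alpha> $ i) \<noteq> 0" for i
    using separable_cofactor[OF roots _ \<open>g \<noteq> 0\<close>, of "\<alpha> $ i"] assms(14) by blast
  hence v_nz: "v $ i \<noteq> 0" for i
    using v_square[of i] by auto

  \<comment> \<open>Twisted polynomials parametrized by their low coefficients\<close>
  define \<Phi> where "\<Phi> f = (\<Sum>i<k. monom (f i) i) + smult (f 0 * \<eta>) P" for f :: "nat \<Rightarrow> 'a"
  have C2: "C2 = range (\<lambda>f. ev \<alpha> v (\<Phi> f))"
    unfolding assms(18,19) pow \<Phi>_def P_def by auto
  have coeff_\<Phi>: "coeff (\<Phi> f) i = f i" if "i < k" for f i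
    using that coeff_P[OF that] by (simp add: \<Phi>_def coeff_sum)
  have deg_\<Phi>: "degree (\<Phi> f) < CARD('n)" for f
  proof -
    have "degree (\<Phi> f) \<le> 2 * k"
      unfolding \<Phi>_def
      by (intro degree_add_le degree_sum_le le_trans[OF degree_monom_le] le_trans[OF degree_smult_le])
        (auto simp: deg_P)
    thus ?thesis
      by (simp add: card_n)
  qed
  \<comment> \<open>The constant coefficient is split off because it alone controls the
    twist.\<close>
  have \<Phi>_pCons: "\<exists>t. \<Phi> f = pCons (f 0) t + smult (f 0 * \<eta>) P \<and> degree (pCons (f 0) t) < k" for f
  proof -
    define p where "p = (\<Sum>i<k. monom (f i) i)"
    have "coeff p 0 = f 0"
      using \<open>k > 1\<close> by (simp add: p_def coeff_sum)
    then obtain t where t: "p = pCons (f 0) t"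
      by (cases p rule: pCons_cases) auto
    have "degree p \<le> k - 1"
      unfolding p_def by (intro degree_sum_le le_trans[OF degree_monom_le]) auto
    thus ?thesis
      using t \<open>k > 1\<close> by (intro exI[of _ t]) (auto simp: \<Phi>_def p_def)
  qed

  \<comment> \<open>Linearity and self-orthogonality of \<open>C2\<close>\<close>
  have "vec.subspace C2"
    unfolding vec.subspace_def
  proof (intro conjI ballI allI)
    have "\<Phi> (\<lambda>_. 0) = 0"
      by (simp add: \<Phi>_def)
    hence "ev \<alpha> v (\<Phi> (\<lambda>_. 0)) = 0"
      by (simp add: ev_def vec_eq_iff)
    thus "0 \<in> C2"
      unfolding C2 by (metis rangeI)
  next
    fix x y assume "x \<in> C2" "y \<in> C2"
    then obtain f f' where "x = ev \<alpha> v (\<Phi> f)" "y = ev \<alpha> v (\<Phi> f')"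
      by (auto simp: C2)
    moreover have "\<Phi> (\<lambda>i. f i + f' i) = \<Phi> f + \<Phi> f'"
      by (simp add: \<Phi>_def sum.distrib smult_add_left distrib_right flip: add_monom)
    ultimately have "x + y = ev \<alpha> v (\<Phi> (\<lambda>i. f i + f' i))"
      by (simp add: ev_add)
    thus "x + y \<in> C2"
      by (auto simp: C2)
  next
    fix y x assume "x \<in> C2"
    then obtain f where "x = ev \<alpha> v (\<Phi> f)"
      by (auto simp: C2)
    moreover have "\<Phi> (\<lambda>i. y * f i) = smult y (\<Phi> f)"
      by (simp add: \<Phi>_def poly_eq_iff coeff_sum algebra_simps)
    ultimately have "y *s x = ev \<alpha> v (\<Phi> (\<lambda>i. y * f i))"
      by (simp add: ev_smult)
    thus "y *s x \<in> C2"
      by (auto simp: C2)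
  qed
  moreover have "C2 \<subseteq> euclidean_dual C2"
  proof -
    have "scalar_product (ev \<alpha> v (\<Phi> f)) (ev \<alpha> v (\<Phi> f')) = 0" for f f'
    proof -
      obtain t t' where t: "\<Phi> f = pCons (f 0) t + smult (f 0 * \<eta>) P" "degree (pCons (f 0) t) < k"
        and t': "\<Phi> f' = pCons (f' 0) t' + smult (f' 0 * \<eta>) P" "degree (pCons (f' 0) t') < k"
        using \<Phi>_pCons by meson
      have "scalar_product (ev \<alpha> v (\<Phi> f)) (ev \<alpha> v (\<Phi> f')) =
          (\<Sum>i\<in>UNIV. (v $ i * v $ i) * (poly (\<Phi> f) (\<alpha> $ i) * poly (\<Phi> f') (\<alpha> $ i)))"
        by (simp add: scalar_product_def ev_def mult_ac)
      also have "\<dots> = (\<Sum>i\<in>UNIV. poly (\<Phi> f) (\<alpha> $ i) * poly (\<Phi> f') (\<alpha> $ i) / poly (pderiv g) (\<alpha> $ i))"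
        by (simp add: v_square divide_inverse mult.commute)
      also have "\<dots> = (\<Sum>x | poly g x = 0. poly (\<Phi> f) x * poly (\<Phi> f') x / poly (pderiv g) x)"
        unfolding assms(14)[symmetric] by (subst sum.reindex[OF assms(15)]) simp
      also have "\<dots> = 0"
        unfolding t(1) t'(1)
        by (rule sum_roots_twisted_div_pderiv_eq_0[OF two roots deg_g g_P V t(2) t'(2)])
      finally show ?thesis .
    qed
    thus ?thesis
      by (auto simp: C2 mem_euclidean_dual)
  qed
  ultimately interpret self_orthogonal_code C2 h
    by unfold_locales (simp_all add: char assms(5))

  \<comment> \<open>The number of codewords\<close>
  have "C2 = (\<lambda>f. ev \<alpha> v (\<Phi> f)) ` ({..<k} \<rightarrow>\<^sub>E UNIV)"
  proof -
    \<comment> \<open>\<open>\<Phi>\<close> reads \<open>f\<close> only below \<open>k\<close>,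
      which includes the index 0 of the twist, so extensional functions suffice for
      counting.\<close>
    have "\<Phi> f = \<Phi> (restrict f {..<k})" for f
      using \<open>k > 1\<close> by (simp add: \<Phi>_def)
    hence "ev \<alpha> v (\<Phi> f) \<in> (\<lambda>f. ev \<alpha> v (\<Phi> f)) ` ({..<k} \<rightarrow>\<^sub>E UNIV)" for f
      by (intro image_eqI[of _ _ "restrict f {..<k}"]) auto
    thus ?thesis
      unfolding C2 by auto
  qed
  moreover have "inj_on (\<lambda>f. ev \<alpha> v (\<Phi> f)) ({..<k} \<rightarrow>\<^sub>E UNIV)"
  proof (rule inj_onI)
    fix f f' assume ff': "f \<in> {..<k} \<rightarrow>\<^sub>E UNIV" "f' \<in> {..<k} \<rightarrow>\<^sub>E UNIV"
      and "ev \<alpha> v (\<Phi> f) = ev \<alpha> v (\<Phi> f')"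
    hence "\<Phi> f = \<Phi> f'"
      using inj_onD[OF inj_on_ev[OF assms(15) v_nz]] deg_\<Phi> by blast
    hence "f i = f' i" if "i < k" for i
      using that coeff_\<Phi> by metis
    with ff' show "f = f'"
      by (intro PiE_ext) auto
  qed
  ultimately have "card C2 = CARD('a) ^ k"
    by (simp add: card_image card_PiE)
  \<comment> \<open>The length exceeds twice the dimension of \<open>C2\<close> by 1, which gives
    \<open>K = 1\<close>.\<close>
  hence "is_quantum_stabilizer_code CARD('n) 1 (wt (euclidean_dual C2 - C2)) CARD('a) quantum_code"
    by (rule is_quantum_stabilizer_code_quantum_code) (simp_all add: card_n)
  thus ?thesis
    unfolding assms(5,13) by blast
qed

end
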